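(* Let $d\ge1$, $m\ge1$ and let $A,B\in{}^{\circlearrowleft}\mathbf I^d_m$ with $A\wr B$. Then the following equality of functions $\mathcal L\to\mathbb Z$ holds: $$I_A=\max\Big(\sum_{X\subsetneq\{0,\dots,d\}}(-1)^{|X|+d}\,I_{m_X(A,B)},\ \sum_{X\subsetneq\{0,\dots,d\}}(-1)^{|X|+d}\,I_{n_X(A,B)}\Big).$$
   Context: ${}^{\circlearrowleft}\mathbf I^d_m$ is the set of $(i_0,\dots,i_d)\in\{1,\dots,m\}^{d+1}$ with $i_x+2\le i_{x+1}$ for $0\le x\le d-1$ and $i_d+2\le i_0+m$. For increasing $(d+1)$-tuples of real numbers $X=(x_0,\dots,x_d)$, $Y=(y_0,\dots,y_d)$, write $X\wr Y$ ($X$ intertwines $Y$) if $x_0<y_0<x_1<y_1<\cdots<x_d<y_d$. Two tuples intertwine in some order if $X\wr Y$ or $Y\wr X$. A generalized lamination is a finite collection of increasing $(d+1)$-tuples from $\mathbb R\setminus\{1,\dots,m\}$ no two of which intertwine (in either order). $\mathcal L$ is the set of all generalized laminations. For an increasing $(d+1)$-tuple $A$ from $\{1,\dots,m\}$, $I_A:\mathcal L\to\mathbb N$ sends $L$ to the number of elements of $L$ which intertwine with $A$ (in some order). For $A=(i_0,\dots,i_d)$, $B=(j_0,\dots,j_d)$ with $A\wr B$ and $X\subseteq\{0,\dots,d\}$, set $m_X(A,B)=\operatorname{sort}(\{i_x\mid x\in X\}\cup\{j_x\mid x\notin X\})$ and $n_X(A,B)=\operatorname{sort}(\{i_x\mid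 x\in X\}\cup\{j_{x-1}\mid x\notin X\})$, where $j_{-1}:=j_d$ and $\operatorname{sort}(K)$ is the tuple of elements of the set $K$ in increasing order. (Maxima and sums of functions are taken pointwise.) *)

theory Defs
  imports Complex_Main
begin

text \<open>A tuple \<open>(x\<^sub>0, \<dots>, x\<^sub>d)\<close> is a list of length \<open>d + 1\<close>, with \<open>x\<^sub>k\<close> the entry \<open>xs ! k\<close>.\<close>

definition increasing_tuples :: "nat \<Rightarrow> 'a::linorder set \<Rightarrow> 'a list set" where
  "increasing_tuples d S = {xs. length xs = d + 1 \<and> sorted_wrt (<) xs \<and> set xs \<subseteq> S}"

definition circ_index_set :: "nat \<Rightarrow> nat \<Rightarrow> nat list set" where
  "circ_index_set m d =
    {i. length i = d + 1 \<and> set i \<subseteq> {1..m} \<and>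
        (\<forall>x<d. i ! x + 2 \<le> i ! (x + 1)) \<and> i ! d + 2 \<le> i ! 0 + m}"

definition intertwines :: "'a::linorder list \<Rightarrow> 'a list \<Rightarrow> bool" (infix "\<wr>" 50) where
  "X \<wr> Y \<longleftrightarrow> length X = length Y \<and>
     (\<forall>k<length X. X ! k < Y ! k) \<and> (\<forall>k. k + 1 < length X \<longrightarrow> Y ! k < X ! (k + 1))"

definition generalized_laminations :: "nat \<Rightarrow> nat \<Rightarrow> real list set set" where
  "generalized_laminations m d =
    {L. finite L \<and> L \<subseteq> increasing_tuples d (UNIV - real ` {1..m}) \<and>
        (\<forall>X\<in>L. \<forall>Y\<in>L. \<not> (X \<wr> Y \<or> Y \<wr> X))}"

definition I_count :: "nat list \<Rightarrow> real list set \<Rightarrow> nat" where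
  "I_count A L = card {X \<in> L. map real A \<wr> X \<or> X \<wr> map real A}"

definition m_tuple :: "nat \<Rightarrow> nat set \<Rightarrow> nat list \<Rightarrow> nat list \<Rightarrow> nat list" where
  "m_tuple d X A B =
    sorted_list_of_set ({A ! x | x. x \<in> X} \<union> {B ! x | x. x \<in> {0..d} - X})"

text \<open>The index \<open>-1\<close> is read as \<open>d\<close>.\<close>

definition n_tuple :: "nat \<Rightarrow> nat set \<Rightarrow> nat list \<Rightarrow> nat list \<Rightarrow> nat list" where
  "n_tuple d X A B =
    sorted_list_of_set
      ({A ! x | x. x \<in> X} \<union> {B ! (if x = 0 then d else x - 1) | x. x \<in> {0..d} - X})"

end

theory Submission
  imports Defs
begin

text \<open>
  The term of either sum that is left out, \<open>X = {0, \<dots>, d}\<close>, would be \<open>- I\<^sub>A\<close>. Hence each sum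
  equals \<open>I\<^sub>A\<close> plus \<open>(-1)\<^sup>d\<close> times the alternating sum over all \<open>X \<subseteq> {0, \<dots>, d}\<close>, and
  these full sums can be computed separately for every tuple \<open>l\<close> of the lamination. With
  \<open>A = (i\<^sub>0, \<dots>, i\<^sub>d)\<close> and \<open>B = (j\<^sub>0, \<dots>, j\<^sub>d)\<close>, the result is that \<open>l\<close> contributes
  \<open>1 - (-1)\<^sup>d\<close> to the full sum of the \<open>m\<^sub>X\<close> if it has

    \<^item> type K: \<open>i\<^sub>k < l\<^sub>k < j\<^sub>k\<close> for all \<open>k\<close>,

  and nothing otherwise (\<open>alternating_sum_crossing_m\<close>); and that it contributes \<open>1 - (-1)\<^sup>d\<close> to
  the full sum of the \<open>n\<^sub>X\<close> if it has

    \<^item> type P: \<open>j\<^sub>k < l\<^sub>k < i\<^sub>k\<^sub>+\<^sub>1\<close> for \<open>k < d\<close> and \<open>j\<^sub>d < l\<^sub>d\<close>, or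
    \<^item> type R: \<open>l\<^sub>0 < i\<^sub>0\<close> and \<open>j\<^sub>k < l\<^sub>k\<^sub>+\<^sub>1 < i\<^sub>k\<^sub>+\<^sub>1\<close> for \<open>k < d\<close>,

  and nothing otherwise (\<open>alternating_sum_crossing_n\<close>). So both sums are at most \<open>I\<^sub>A\<close>, and for
  even \<open>d\<close> both are equal to it. For odd \<open>d\<close>, one sum could fall short of \<open>I\<^sub>A\<close> only through a
  tuple of type K, the other only through one of type P or R. But a tuple of type K
  intertwines every tuple of type P, and every tuple of type R intertwines it; a lamination
  cannot contain both, and the maximum is \<open>I\<^sub>A\<close>.

  The computation for one tuple rests on intertwining being an entrywise condition: the
  entries of \<open>l\<close> cut the line into slots, and \<open>T \<wr> l\<close> or \<open>l \<wr> T\<close> says that each entry of \<open>T\<close> lies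
  in a prescribed slot. The indicators are therefore products over the entries, an
  alternating sum over \<open>X\<close> of such products factors (\<open>alternating_sum_prod\<close>), and the factors
  determine the position of \<open>l\<close> one entry after the other (\<open>prod_slot_diff_upward\<close>,
  \<open>prod_slot_diff_downward\<close>).
\<close>

section \<open>Alternating sums and telescoping products\<close>

lemma alternating_sum_prod:
  fixes f g :: "'a \<Rightarrow> int"
  assumes "finite S"
  shows "(\<Sum>X\<in>Pow S. (-1) ^ card X * (\<Prod>k\<in>S. if k \<in> X then f k else g k)) = (\<Prod>k\<in>S. g k - f k)"
proof -
  have "(\<Prod>k\<in>S. g k - f k) = (\<Prod>k\<in>S. - f k + g k)"
    by simp
  also have "\<dots> = (\<Sum>X\<in>Pow S. (\<Prod>k\<in>X. - f k) * prod g (S - X))"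
    by (rule prod_add) (rule assms)
  also have "\<dots> = (\<Sum>X\<in>Pow S. (-1) ^ card X * (\<Prod>k\<in>S. if k \<in> X then f k else g k))"
  proof (rule sum.cong)
    fix X assume "X \<in> Pow S"
    hence "X \<subseteq> S" by simp
    hence "(\<Prod>k\<in>S. if k \<in> X then f k else g k) = prod f X * prod g (S - X)"
      using assms by (simp add: prod.If_cases Int_absorb1 Diff_eq)
    thus "(\<Prod>k\<in>X. - f k) * prod g (S - X) = (-1) ^ card X * (\<Prod>k\<in>S. if k \<in> X then f k else g k)"
      by (simp add: prod_uminus)
  qed simp
  finally show ?thesis by simp
qed

definition slot :: "(nat \<Rightarrow> real) \<Rightarrow> nat \<Rightarrow> real \<Rightarrow> int" where
  "slot z k p = of_bool (z k < p \<and> p < z (Suc k))"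

text \<open>
  A factor compares two points \<open>a k < b k\<close> with the slot between \<open>z k\<close> and \<open>z (Suc k)\<close>. As soon
  as \<open>z k\<close> is known to lie below \<open>a k\<close>, the factor only asks whether \<open>z (Suc k)\<close> separates
  \<open>a k\<close> from \<open>b k\<close>; and if it does, \<open>z (Suc k)\<close> lies below \<open>a (Suc k)\<close>. So knowledge of the lowest
  cut point propagates upward.
\<close>

lemma prod_slot_diff_upward:
  fixes a b z :: "nat \<Rightarrow> real"
  assumes "z 0 < a 0" and "\<And>k. k < n \<Longrightarrow> a k < b k" and "\<And>k. Suc k < n \<Longrightarrow> b k \<le> a (Suc k)"
    and "\<And>k. k < n \<Longrightarrow> z (Suc k) \<noteq> b k"
  shows "(\<Prod>k<n. slot z k (a k) - slot z k (b k)) = of_bool (\<forall>k<n. a k < z (Suc k) \<and> z (Suc k) < b k)"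
  using assms
proof (induction n)
  case (Suc n)
  let ?C = "\<lambda>n. \<forall>k<n. a k < z (Suc k) \<and> z (Suc k) < b k"
  have IH: "(\<Prod>k<n. slot z k (a k) - slot z k (b k)) = of_bool (?C n)"
    by (rule Suc.IH) (use Suc.prems in auto)
  show ?case
  proof (cases "?C n")
    case True
    have "z n < a n"
    proof (cases n)
      case 0
      thus ?thesis using Suc.prems(1) by simp
    next
      case (Suc l)
      hence "z n < b l" and "b l \<le> a n"
        using True Suc.prems(3)[of l] by auto
      thus ?thesis by simp
    qed
    hence "slot z n (a n) - slot z n (b n) = of_bool (a n < z (Suc n) \<and> z (Suc n) < b n)"
      using Suc.prems(2)[of n] Suc.prems(4)[of n] by (auto simp: slot_def)
    thus ?thesis using True by (auto simp: IH less_Suc_eq)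
  next
    case False
    thus ?thesis by (auto simp: IH)
  qed
qed simp

text \<open>
  The mirror image: knowing that the upper end of the last slot lies above all points, one
  finds that the factors ask, from the top down, whether the lower ends \<open>z k\<close> separate \<open>a k\<close> from
  \<open>b k\<close>. Now \<open>b k\<close> is the point inside the slot, so every factor carries a sign.
\<close>

lemma prod_slot_diff_downward:
  fixes a b z :: "nat \<Rightarrow> real"
  assumes "n = 0 \<or> b (n - 1) < z n" and "\<And>k. k < n \<Longrightarrow> a k < b k"
    and "\<And>k. Suc k < n \<Longrightarrow> b k \<le> a (Suc k)" and "\<And>k. k < n \<Longrightarrow> z k \<noteq> a k"
  shows "(\<Prod>k<n. slot z k (a k) - slot z k (b k)) = (-1) ^ n * of_bool (\<forall>k<n. a k < z k \<and> z k < b k)"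
  using assms
proof (induction n)
  case (Suc n)
  have last: "slot z n (a n) - slot z n (b n) = - of_bool (a n < z n \<and> z n < b n)"
    using Suc.prems(1) Suc.prems(2)[of n] Suc.prems(4)[of n] by (auto simp: slot_def)
  show ?case
  proof (cases "a n < z n \<and> z n < b n")
    case True
    have "n = 0 \<or> b (n - 1) < z n"
      using True Suc.prems(3)[of "n - 1"] by (cases n) auto
    hence "(\<Prod>k<n. slot z k (a k) - slot z k (b k)) = (-1) ^ n * of_bool (\<forall>k<n. a k < z k \<and> z k < b k)"
      by (rule Suc.IH) (use Suc.prems in auto)
    thus ?thesis using True by (auto simp: last less_Suc_eq)
  next
    case False
    thus ?thesis by (auto simp: last)
  qed
qed simp

section \<open>Crossings with one tuple\<close>

definition crossing :: "real list \<Rightarrow> real list \<Rightarrow> int" where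
  "crossing T l = of_bool (T \<wr> l \<or> l \<wr> T)"

lemma prod_of_bool_lessThan:
  fixes n :: nat
  shows "(\<Prod>k<n. of_bool (P k) :: int) = of_bool (\<forall>k<n. P k)"
  by (induction n) (auto simp: less_Suc_eq)

text \<open>
  The entries of \<open>l\<close> have a slot below the first and a slot above the last one. Artificial
  cut points \<open>lo\<close> and \<open>hi\<close> make them slots like the others; they only have to lie
  beyond the first and the last entry of \<open>T\<close>. Then \<open>T \<wr> l\<close> puts the \<open>k\<close>-th entry of \<open>T\<close> into slot \<open>k\<close>, and \<open>l \<wr> T\<close> puts it into
  slot \<open>k + 1\<close>.
\<close>

lemma crossing_eq_prod_slot:
  fixes t :: "nat \<Rightarrow> real"
  assumes len: "length l = Suc d" and z: "z = (!) (lo # l @ [hi])"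
    and lo: "lo < t 0" and hi: "t d < hi"
  shows "crossing (map t [0..<Suc d]) l =
    (\<Prod>k<Suc d. slot z k (t k)) + (\<Prod>k<Suc d. slot z (Suc k) (t k))"
proof -
  let ?T = "map t [0..<Suc d]"
  have T: "?T ! k = t k" if "k < Suc d" for k
    using that by (simp del: upt_Suc)
  have z0: "z 0 = lo" and zS: "\<And>k. k < Suc d \<Longrightarrow> z (Suc k) = l ! k" and zhi: "z (Suc (Suc d)) = hi"
    using len by (auto simp: z nth_append)
  have "?T \<wr> l \<longleftrightarrow> (\<forall>k<Suc d. z k < t k \<and> t k < z (Suc k))"
  proof -
    have "(\<forall>k<Suc d. z k < t k) \<longleftrightarrow> (\<forall>k<d. l ! k < t (Suc k))"
      using lo z0 zS by (auto simp: All_less_Suc2)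
    moreover have "(\<forall>k. k + 1 < length ?T \<longrightarrow> l ! k < ?T ! (k + 1)) \<longleftrightarrow> (\<forall>k<d. l ! k < t (Suc k))"
      using T by (auto simp del: upt_Suc)
    moreover have "(\<forall>k<length ?T. ?T ! k < l ! k) \<longleftrightarrow> (\<forall>k<Suc d. t k < z (Suc k))"
      using T zS by (auto simp del: upt_Suc)
    ultimately show ?thesis
      unfolding intertwines_def using len by auto
  qed
  moreover have "l \<wr> ?T \<longleftrightarrow> (\<forall>k<Suc d. z (Suc k) < t k \<and> t k < z (Suc (Suc k)))"
  proof -
    have "(\<forall>k<Suc d. t k < z (Suc (Suc k))) \<longleftrightarrow> (\<forall>k<d. t k < l ! Suc k)"
      using hi zhi zS by (auto simp: All_less_Suc)
    moreover have "(\<forall>k. k + 1 < length l \<longrightarrow> ?T ! k < l ! (k + 1)) \<longleftrightarrow> (\<forall>k<d. t k < l ! Suc k)"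
      using T len by (auto simp del: upt_Suc)
    moreover have "(\<forall>k<length l. l ! k < ?T ! k) \<longleftrightarrow> (\<forall>k<Suc d. z (Suc k) < t k)"
      using T zS len by (auto simp del: upt_Suc)
    ultimately show ?thesis
      unfolding intertwines_def using len by auto
  qed
  moreover have "crossing ?T l = of_bool (?T \<wr> l) + of_bool (l \<wr> ?T)"
  proof -
    have "?T ! 0 < l ! 0" if "?T \<wr> l"
      using that len by (simp add: intertwines_def del: upt_Suc)
    moreover have "l ! 0 < ?T ! 0" if "l \<wr> ?T"
      using that len by (simp add: intertwines_def del: upt_Suc)
    ultimately have "\<not> (?T \<wr> l \<and> l \<wr> ?T)" by fastforce
    thus ?thesis unfolding crossing_def by (cases "?T \<wr> l"; cases "l \<wr> ?T") simp_all
  qed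
  ultimately show ?thesis
    unfolding slot_def prod_of_bool_lessThan by simp
qed

section \<open>The two alternating sums for a single tuple\<close>

text \<open>
  If \<open>l\<close> lies strictly between \<open>A\<close> and \<open>B\<close> entry by entry, the two relations \<open>m\<^sub>X \<wr> l\<close> and \<open>l \<wr> m\<^sub>X\<close>
  hold for one \<open>X\<close> each, namely for \<open>X = {0, \<dots>, d}\<close> and for \<open>X = {}\<close>; in all other cases the
  sum cancels. The two products are evaluated from opposite ends: the one for \<open>m\<^sub>X \<wr> l\<close> from the
  artificial cut point below all entries, the one for \<open>l \<wr> m\<^sub>X\<close> from that above them.
\<close>

lemma alternating_sum_crossing_m:
  fixes i j :: "nat \<Rightarrow> real"
  assumes len: "length l = Suc d"
    and ij: "\<And>k. k \<le> d \<Longrightarrow> i k < j k" and ji: "\<And>k. k < d \<Longrightarrow> j k < i (Suc k)"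
    and ne: "\<And>k k'. k \<le> d \<Longrightarrow> k' \<le> d \<Longrightarrow> l ! k \<noteq> i k' \<and> l ! k \<noteq> j k'"
  shows "(\<Sum>X\<in>Pow {..<Suc d}. (-1) ^ card X *
            crossing (map (\<lambda>k. if k \<in> X then i k else j k) [0..<Suc d]) l)
       = (1 - (-1) ^ d) * of_bool (\<forall>k\<le>d. i k < l ! k \<and> l ! k < j k)"
proof -
  define z where "z = (!) ((i 0 - 1) # l @ [j d + 1])"
  define K where "K \<longleftrightarrow> (\<forall>k\<le>d. i k < l ! k \<and> l ! k < j k)"
  have z0: "z 0 = i 0 - 1" and zS: "\<And>k. k < Suc d \<Longrightarrow> z (Suc k) = l ! k"
    and zhi: "z (Suc (Suc d)) = j d + 1"
    using len by (auto simp: z_def nth_append)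
  have neg: "(\<Prod>k<Suc d. slot w k (j k) - slot w k (i k))
      = (-1) ^ Suc d * (\<Prod>k<Suc d. slot w k (i k) - slot w k (j k))" for w
  proof -
    have "(\<Prod>k<Suc d. slot w k (j k) - slot w k (i k))
        = (\<Prod>k<Suc d. - (slot w k (i k) - slot w k (j k)))"
      by (rule prod.cong) auto
    thus ?thesis unfolding prod_uminus by simp
  qed
  have up: "(\<Prod>k<Suc d. slot z k (i k) - slot z k (j k)) = of_bool K"
    by (subst prod_slot_diff_upward)
       (use ij ji ne in \<open>auto simp: z0 zS K_def less_Suc_eq_le intro: less_imp_le\<close>)
  have down: "(\<Prod>k<Suc d. slot (\<lambda>k. z (Suc k)) k (i k) - slot (\<lambda>k. z (Suc k)) k (j k))
      = (-1) ^ Suc d * of_bool K"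
    by (subst prod_slot_diff_downward)
       (use ij ji ne in \<open>auto simp: zhi zS K_def less_Suc_eq_le intro: less_imp_le\<close>)
  have cr: "crossing (map (\<lambda>k. if k \<in> X then i k else j k) [0..<Suc d]) l
      = (\<Prod>k<Suc d. if k \<in> X then slot z k (i k) else slot z k (j k))
      + (\<Prod>k<Suc d. if k \<in> X then slot (\<lambda>k. z (Suc k)) k (i k) else slot (\<lambda>k. z (Suc k)) k (j k))" for X
  proof -
    have "i 0 < j 0" "i d < j d" using ij by auto
    hence "crossing (map (\<lambda>k. if k \<in> X then i k else j k) [0..<Suc d]) l
      = (\<Prod>k<Suc d. slot z k (if k \<in> X then i k else j k))
      + (\<Prod>k<Suc d. slot z (Suc k) (if k \<in> X then i k else j k))"
      by (intro crossing_eq_prod_slot[OF len z_def]) auto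
    thus ?thesis by (simp only: slot_def if_distrib)
  qed
  show ?thesis
    unfolding cr distrib_left sum.distrib alternating_sum_prod[OF finite_lessThan] neg up down K_def[symmetric]
    by (simp add: algebra_simps flip: power_mult_distrib)
qed

text \<open>
  The entries of \<open>n\<^sub>X\<close> in increasing order. The choices are \<open>i k\<close> or \<open>j (k - 1)\<close> for \<open>k > 0\<close>, which
  lie next to each other, and \<open>i 0\<close> or \<open>j d\<close>, which are the extreme points. Thus all the other
  entries move down by one position when \<open>j d\<close> is chosen.
\<close>

definition n_entry :: "nat \<Rightarrow> nat set \<Rightarrow> (nat \<Rightarrow> 'a) \<Rightarrow> (nat \<Rightarrow> 'a) \<Rightarrow> nat \<Rightarrow> 'a" where
  "n_entry d X i j k =
    (if 0 \<in> X then (if k \<in> X then i k else j (k - 1))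
     else if k = d then j d else if Suc k \<in> X then i (Suc k) else j k)"

text \<open>
  Splitting off the choice between \<open>i 0\<close> and \<open>j d\<close> leaves \<open>d\<close> binary choices, and the shift by one
  position when \<open>j d\<close> is chosen makes \<open>n\<^sub>X \<wr> l\<close> with \<open>0 \<in> X\<close> and \<open>l \<wr> n\<^sub>X\<close> with \<open>0 \<notin> X\<close> use the same slots
  for these choices. Their common product \<open>G 1\<close> has no end from which it could be evaluated,
  but it occurs with the factor \<open>[l ! d < j d] - [i 0 < l ! 0]\<close>, which is the same as
  \<open>[l ! 0 < i 0] - [j d < l ! d]\<close>; the first of these conditions allows an evaluation from
  below, the second one from above. The remaining products \<open>G 0\<close> and \<open>G 2\<close> belong to
  \<open>n\<^sub>X \<wr> l\<close> with \<open>0 \<notin> X\<close> and to \<open>l \<wr> n\<^sub>X\<close> with \<open>0 \<in> X\<close>.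
\<close>

lemma alternating_sum_crossing_n:
  fixes i j :: "nat \<Rightarrow> real"
  assumes len: "length l = Suc d"
    and ij: "\<And>k. k \<le> d \<Longrightarrow> i k < j k" and ji: "\<And>k. k < d \<Longrightarrow> j k < i (Suc k)"
    and ne: "\<And>k k'. k \<le> d \<Longrightarrow> k' \<le> d \<Longrightarrow> l ! k \<noteq> i k' \<and> l ! k \<noteq> j k'"
  shows "(\<Sum>X\<in>Pow {..<Suc d}. (-1) ^ card X *
            crossing (map (n_entry d X i j) [0..<Suc d]) l)
       = (1 - (-1) ^ d) *
           (of_bool ((\<forall>k<d. j k < l ! k \<and> l ! k < i (Suc k)) \<and> j d < l ! d)
          + of_bool (l ! 0 < i 0 \<and> (\<forall>k<d. j k < l ! Suc k \<and> l ! Suc k < i (Suc k))))"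
proof -
  define z where "z = (!) ((i 0 - 1) # l @ [j d + 1])"
  define P where "P \<longleftrightarrow> (\<forall>k<d. j k < l ! k \<and> l ! k < i (Suc k)) \<and> j d < l ! d"
  define R where "R \<longleftrightarrow> l ! 0 < i 0 \<and> (\<forall>k<d. j k < l ! Suc k \<and> l ! Suc k < i (Suc k))"
  have z0: "z 0 = i 0 - 1" and zS: "\<And>k. k < Suc d \<Longrightarrow> z (Suc k) = l ! k"
    and zhi: "z (Suc (Suc d)) = j d + 1"
    using len by (auto simp: z_def nth_append)
  have ij0: "i 0 < j 0" and ijd: "i d < j d" using ij by auto
  have step: "j k < j (Suc k)" "i k < i (Suc k)" if "k < d" for k
    using ij[of k] ij[of "Suc k"] ji[of k] that by auto
  define C where "C s X = (\<Prod>k<d. if Suc k \<in> X then slot z (k + s) (i (Suc k)) else slot z (k + s) (j k))"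
    for s X
  define G where "G s = (\<Prod>k<d. slot (\<lambda>k. z (k + s)) k (j k) - slot (\<lambda>k. z (k + s)) k (i (Suc k)))" for s
  \<comment> \<open>A factor 0 switches off the products that do not occur for the given choice at 0.\<close>
  have cr: "crossing (map (n_entry d X i j) [0..<Suc d]) l
      = (if 0 \<in> X then 0 else slot z d (j d)) * C 0 X
      + (if 0 \<in> X then slot z 0 (i 0) else slot z (Suc d) (j d)) * C 1 X
      + (if 0 \<in> X then slot z 1 (i 0) else 0) * C 2 X" for X
  proof -
    have "crossing (map (n_entry d X i j) [0..<Suc d]) l
        = (\<Prod>k<Suc d. slot z k (n_entry d X i j k)) + (\<Prod>k<Suc d. slot z (Suc k) (n_entry d X i j k))"
    proof (rule crossing_eq_prod_slot[OF len z_def])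
      show "i 0 - 1 < n_entry d X i j 0"
        using ij0 step(2)[of 0] by (cases "d = 0") (auto simp: n_entry_def)
      show "n_entry d X i j d < j d + 1"
        using ijd step(1)[of "d - 1"] by (cases "d = 0") (auto simp: n_entry_def)
    qed
    moreover have "(\<Prod>k<Suc d. slot z (k + s) (n_entry d X i j k))
        = (if 0 \<in> X then slot z s (i 0) * C (Suc s) X else slot z (d + s) (j d) * C s X)" for s
    proof (cases "0 \<in> X")
      case True
      have "(\<Prod>k<d. slot z (Suc k + s) (n_entry d X i j (Suc k))) = C (Suc s) X"
        unfolding C_def by (rule prod.cong) (use True in \<open>auto simp: n_entry_def\<close>)
      thus ?thesis
        unfolding prod.lessThan_Suc_shift using True by (simp add: n_entry_def)
    next
      case False
      have "(\<Prod>k<d. slot z (k + s) (n_entry d X i j k)) = C s X"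
        unfolding C_def by (rule prod.cong) (use False in \<open>auto simp: n_entry_def\<close>)
      thus ?thesis using False by (simp add: n_entry_def)
    qed
    from this[of 0] this[of 1] show ?thesis
      unfolding calculation by (simp add: numeral_2_eq_2)
  qed
  have alt: "(\<Sum>X\<in>Pow {..<Suc d}. (-1) ^ card X * ((if 0 \<in> X then p else q) * C s X)) = (q - p) * G s"
    for p q :: int and s
  proof -
    \<comment> \<open>The choice at 0 becomes one more factor, so that all \<open>d + 1\<close> choices are summed at once.\<close>
    let ?f = "\<lambda>k. case k of 0 \<Rightarrow> p | Suc k \<Rightarrow> slot z (k + s) (i (Suc k))"
    let ?g = "\<lambda>k. case k of 0 \<Rightarrow> q | Suc k \<Rightarrow> slot z (k + s) (j k)"
    have "(if 0 \<in> X then p else q) * C s X = (\<Prod>k<Suc d. if k \<in> X then ?f k else ?g k)" for X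
      unfolding prod.lessThan_Suc_shift C_def by (simp cong: if_cong)
    moreover have "(q - p) * G s = (\<Prod>k<Suc d. ?g k - ?f k)"
      unfolding prod.lessThan_Suc_shift G_def by (simp add: slot_def)
    ultimately show ?thesis
      by (simp only: alternating_sum_prod[OF finite_lessThan])
  qed
  have up: "G s = of_bool (\<forall>k<d. j k < z (Suc k + s) \<and> z (Suc k + s) < i (Suc k))"
    if "z s < j 0" "s \<le> 1" for s
    unfolding G_def
    by (subst prod_slot_diff_upward)
       (use that ij ji ne in \<open>auto simp: zS less_imp_le\<close>)
  have down: "G s = (-1) ^ d * of_bool (\<forall>k<d. j k < z (k + s) \<and> z (k + s) < i (Suc k))"
    if "i d < z (d + s)" "1 \<le> s" "s \<le> 2" for s
  proof -
    obtain r where r: "s = Suc r" "r \<le> 1" using \<open>1 \<le> s\<close> \<open>s \<le> 2\<close> by (cases s) auto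
    have last: "d = 0 \<or> i (Suc (d - Suc 0)) < z (Suc (d + r))"
      using that(1) r by (cases d) auto
    show ?thesis unfolding G_def
      by (subst prod_slot_diff_downward)
         (use that ij ji ne in \<open>auto simp: zS less_imp_le r last\<close>)
  qed
  have "slot z d (j d) * G 0 = of_bool P"
  proof -
    have "z d < j d" if "\<forall>k<d. j k < l ! k \<and> l ! k < i (Suc k)"
      using that ij0 ijd by (cases d) (force simp: z0 zS)+
    moreover have "G 0 = of_bool (\<forall>k<d. j k < l ! k \<and> l ! k < i (Suc k))"
      using ij0 by (subst up) (auto simp: z0 zS)
    ultimately show ?thesis by (auto simp: P_def slot_def zS)
  qed
  moreover have "slot z 1 (i 0) * G 2 = (-1) ^ d * of_bool R"
  proof -
    have "i 0 < z 2" if "\<forall>k<d. j k < l ! Suc k \<and> l ! Suc k < i (Suc k)"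
      using that ij0 zhi by (cases d) (force simp: zS numeral_2_eq_2)+
    moreover have "G 2 = (-1) ^ d * of_bool (\<forall>k<d. j k < l ! Suc k \<and> l ! Suc k < i (Suc k))"
      using ijd by (subst down) (auto simp: zhi zS numeral_2_eq_2)
    ultimately show ?thesis by (auto simp: R_def slot_def zS numeral_2_eq_2)
  qed
  moreover have "(slot z (Suc d) (j d) - slot z 0 (i 0)) * G 1 = of_bool R - (-1) ^ d * of_bool P"
  proof -
    have "slot z (Suc d) (j d) - slot z 0 (i 0) = of_bool (l ! 0 < i 0) - of_bool (j d < l ! d)"
      using ne[of d d] ne[of 0 0] by (auto simp: slot_def zS zhi z0)
    moreover have "of_bool (l ! 0 < i 0) * G 1 = of_bool R"
      using up[of 1] ij0 by (auto simp: R_def zS)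
    moreover have "of_bool (j d < l ! d) * G 1 = (-1) ^ d * of_bool P"
      using down[of 1] ijd by (auto simp: P_def zS)
    ultimately show ?thesis by (simp only: left_diff_distrib)
  qed
  ultimately show ?thesis
    unfolding cr distrib_left sum.distrib alt P_def[symmetric] R_def[symmetric]
    by (simp add: algebra_simps)
qed

section \<open>Summation over a lamination\<close>

lemma image_if_mem:
  assumes "X \<subseteq> S"
  shows "(\<lambda>x. if x \<in> X then f x else g x) ` S = {f x | x. x \<in> X} \<union> {g x | x. x \<in> S - X}"
proof -
  let ?h = "\<lambda>x. if x \<in> X then f x else g x"
  have "?h ` S = ?h ` X \<union> ?h ` (S - X)"
    by (simp only: image_Un[symmetric] Un_Diff_cancel Un_absorb1[OF assms])
  also have "?h ` X = f ` X"
    by (rule image_cong) auto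
  also have "?h ` (S - X) = g ` (S - X)"
    by (rule image_cong) auto
  finally show ?thesis by (simp only: Setcompr_eq_image)
qed

lemma m_tuple_eq_map:
  assumes "A \<wr> B" "length A = Suc d" "X \<subseteq> {0..d}"
  shows "m_tuple d X A B = map (\<lambda>k. if k \<in> X then A ! k else B ! k) [0..<Suc d]" (is "_ = ?T")
proof -
  have set: "set ?T = {A ! x | x. x \<in> X} \<union> {B ! x | x. x \<in> {0..d} - X}"
    unfolding image_if_mem[OF assms(3), symmetric]
    by (simp only: set_map set_upt atLeastLessThanSuc_atLeastAtMost)
  have "(if k \<in> X then A ! k else B ! k) < (if Suc k \<in> X then A ! Suc k else B ! Suc k)"
    if "k < d" for k
  proof -
    have "A ! k < B ! k" "B ! k < A ! Suc k" "A ! Suc k < B ! Suc k"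
      using assms(1,2) that by (auto simp: intertwines_def)
    thus ?thesis by simp
  qed
  hence "sorted_wrt (<) ?T"
    unfolding sorted_wrt_iff_nth_Suc_transp[OF transp_on_less]
    by (simp del: upt_Suc if_split cong: if_cong)
  thus ?thesis
    unfolding m_tuple_def set[symmetric]
    by (simp add: strict_sorted_iff sorted_list_of_set.idem_if_sorted_distinct del: upt_Suc set_map set_upt)
qed

lemma n_tuple_eq_map:
  assumes "A \<wr> B" "length A = Suc d" "X \<subseteq> {0..d}"
  shows "n_tuple d X A B = map (n_entry d X ((!) A) ((!) B)) [0..<Suc d]" (is "_ = ?T")
proof -
  have AB: "A ! k < B ! k" if "k \<le> d" for k
    using assms(1,2) that by (auto simp: intertwines_def)
  have BA: "B ! k < A ! Suc k" if "k < d" for k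
    using assms(1,2) that by (auto simp: intertwines_def)
  \<comment> \<open>Listing the choices by \<open>x\<close> instead of by size; if \<open>0 \<notin> X\<close> the two orders differ by a rotation.\<close>
  define h where "h x = (if x \<in> X then A ! x else B ! (if x = 0 then d else x - 1))" for x
  have "set ?T = n_entry d X ((!) A) ((!) B) ` {0..d}"
    by (simp only: set_map set_upt atLeastLessThanSuc_atLeastAtMost)
  also have "\<dots> = h ` {0..d}"
  proof (cases "0 \<in> X")
    case True
    thus ?thesis by (intro image_cong) (auto simp: n_entry_def h_def)
  next
    case False
    have "n_entry d X ((!) A) ((!) B) ` {0..d} = h ` (\<lambda>k. if k = d then 0 else Suc k) ` {0..d}"
      unfolding image_image using False by (intro image_cong) (auto simp: n_entry_def h_def)
    also have "(\<lambda>k. if k = d then 0 else Suc k) ` {0..d} = {0..d}"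
    proof (intro equalityI subsetI)
      fix x assume "x \<in> {0..d}"
      thus "x \<in> (\<lambda>k. if k = d then 0 else Suc k) ` {0..d}"
        by (intro image_eqI[of _ _ "if x = 0 then d else x - 1"]) auto
    qed auto
    finally show ?thesis .
  qed
  also have "\<dots> = {A ! x | x. x \<in> X} \<union> {B ! (if x = 0 then d else x - 1) | x. x \<in> {0..d} - X}"
    unfolding h_def by (rule image_if_mem) (rule assms(3))
  finally have set: "set ?T = \<dots>" .
  have "n_entry d X ((!) A) ((!) B) k < n_entry d X ((!) A) ((!) B) (Suc k)" if "k < d" for k
    using AB[of k] AB[of "Suc k"] BA[of k] BA[of "k - 1"] BA[of "Suc k"] AB[of d] that
    by (cases k; cases "Suc k = d") (auto simp: n_entry_def)
  hence "sorted_wrt (<) ?T"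
    unfolding sorted_wrt_iff_nth_Suc_transp[OF transp_on_less] by (simp del: upt_Suc)
  thus ?thesis
    unfolding n_tuple_def set[symmetric]
    by (simp add: strict_sorted_iff sorted_list_of_set.idem_if_sorted_distinct del: upt_Suc set_map set_upt)
qed

lemma I_count_eq_sum_crossing:
  fixes L :: "real list set"
  assumes "finite L"
  shows "int (I_count A L) = (\<Sum>l\<in>L. crossing (map real A) l)"
proof -
  let ?P = "\<lambda>l. map real A \<wr> l \<or> l \<wr> map real A"
  have "(\<Sum>l\<in>L. of_bool (?P l) :: int) = int (card (L \<inter> Collect ?P))"
    by (rule sum_of_bool_eq) (fact assms)+
  thus ?thesis by (simp only: I_count_def crossing_def Int_def mem_Collect_eq)
qed

text \<open>
  The passage from one tuple to the whole lamination, for both families \<open>m\<^sub>X\<close> and \<open>n\<^sub>X\<close>: the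
  term of the full set is moved to the other side. The factor \<open>(-1)\<^sup>d\<close> of the full sum becomes
  a minus sign because \<open>1 - (-1)\<^sup>d\<close> vanishes for even \<open>d\<close>.
\<close>

lemma exchange_sum_eq:
  assumes "finite L" and all: "t {0..d} = A"
    and defect: "\<And>l. l \<in> L \<Longrightarrow>
      (\<Sum>X\<in>Pow {..<Suc d}. (-1) ^ card X * crossing (map real (t X)) l) = (1 - (-1) ^ d) * e l"
  shows "(\<Sum>X | X \<subset> {0..d}. (-1) ^ (card X + d) * int (I_count (t X) L))
       = int (I_count A L) - (1 - (-1) ^ d) * (\<Sum>l\<in>L. e l)"
proof -
  have "Pow {..<Suc d} = insert {0..d} {X. X \<subset> {0..d}}"
    by (auto simp: lessThan_Suc_atMost atMost_atLeast0)
  moreover have "finite {X. X \<subset> {0..d}}"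
    by (rule finite_subset[of _ "Pow {0..d}"]) auto
  ultimately have "(\<Sum>X\<in>Pow {..<Suc d}. (-1) ^ (card X + d) * int (I_count (t X) L))
      = - int (I_count A L) + (\<Sum>X | X \<subset> {0..d}. (-1) ^ (card X + d) * int (I_count (t X) L))"
    by (simp add: all flip: power_mult_distrib)
  moreover have "(\<Sum>X\<in>Pow {..<Suc d}. (-1) ^ (card X + d) * int (I_count (t X) L))
      = (-1) ^ d * (\<Sum>l\<in>L. \<Sum>X\<in>Pow {..<Suc d}. (-1) ^ card X * crossing (map real (t X)) l)"
    unfolding I_count_eq_sum_crossing[OF assms(1)] sum_distrib_left
    by (subst sum.swap) (simp add: power_add mult_ac)
  moreover have "\<dots> = (-1) ^ d * ((1 - (-1) ^ d) * (\<Sum>l\<in>L. e l))"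
    by (simp only: sum_distrib_left[symmetric] defect cong: sum.cong)
  moreover have "\<dots> = - ((1 - (-1) ^ d) * (\<Sum>l\<in>L. e l))"
    by (cases "even d") auto
  ultimately show ?thesis by simp
qed

theorem theorem7p1:
  fixes d m :: nat and A B :: "nat list"
  assumes "d \<ge> 1" and "m \<ge> 1"
    and "A \<in> circ_index_set m d" and "B \<in> circ_index_set m d"
    and "A \<wr> B"
  shows "\<forall>L \<in> generalized_laminations m d.
    int (I_count A L) =
      max (\<Sum>X | X \<subset> {0..d}. (-1) ^ (card X + d) * int (I_count (m_tuple d X A B) L))
          (\<Sum>X | X \<subset> {0..d}. (-1) ^ (card X + d) * int (I_count (n_tuple d X A B) L))"
proof
  fix L assume L: "L \<in> generalized_laminations m d"
  define i j where "i = (\<lambda>k. real (A ! k))" and "j = (\<lambda>k. real (B ! k))"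
  have fin: "finite L" and noncross: "\<And>X Y. X \<in> L \<Longrightarrow> Y \<in> L \<Longrightarrow> \<not> X \<wr> Y"
    using L by (auto simp: generalized_laminations_def)
  have lenA: "length A = Suc d" and lenB: "length B = Suc d"
    and inA: "set A \<subseteq> {1..m}" and inB: "set B \<subseteq> {1..m}"
    using assms by (auto simp: circ_index_set_def)
  have len: "length l = Suc d" and avoid: "set l \<inter> real ` {1..m} = {}" if "l \<in> L" for l
    using L that by (auto simp: generalized_laminations_def increasing_tuples_def)
  have ij: "i k < j k" if "k \<le> d" for k
    using assms(5) lenA that by (auto simp: intertwines_def i_def j_def)
  have ji: "j k < i (Suc k)" if "k < d" for k
    using assms(5) lenA that by (auto simp: intertwines_def i_def j_def)
  have ne: "l ! k \<noteq> i k' \<and> l ! k \<noteq> j k'" if "l \<in> L" "k \<le> d" "k' \<le> d" for l k k'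
  proof -
    have "l ! k \<in> set l" using len that by auto
    moreover have "A ! k' \<in> {1..m}" "B ! k' \<in> {1..m}"
      using inA inB lenA lenB that nth_mem[of k' A] nth_mem[of k' B] by (auto simp del: nth_mem)
    ultimately show ?thesis using avoid[OF that(1)] by (auto simp: i_def j_def)
  qed
  define K where "K l \<longleftrightarrow> (\<forall>k\<le>d. i k < l ! k \<and> l ! k < j k)" for l
  define P where "P l \<longleftrightarrow> (\<forall>k<d. j k < l ! k \<and> l ! k < i (Suc k)) \<and> j d < l ! d" for l
  define R where "R l \<longleftrightarrow> l ! 0 < i 0 \<and> (\<forall>k<d. j k < l ! Suc k \<and> l ! Suc k < i (Suc k))" for l
  define M where "M = (\<Sum>l\<in>L. of_bool (K l) :: int)"
  define N where "N = (\<Sum>l\<in>L. of_bool (P l) + of_bool (R l) :: int)"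
  have m: "map real (m_tuple d X A B) = map (\<lambda>k. if k \<in> X then i k else j k) [0..<Suc d]"
    if "X \<subseteq> {0..d}" for X
    using m_tuple_eq_map[OF assms(5) lenA that] by (simp add: i_def j_def if_distrib)
  have n: "map real (n_tuple d X A B) = map (n_entry d X i j) [0..<Suc d]"
    if "X \<subseteq> {0..d}" for X
    using n_tuple_eq_map[OF assms(5) lenA that] by (simp add: i_def j_def n_entry_def)
  have A: "map ((!) A) [0..<Suc d] = A"
    using map_nth[of A] lenA by simp
  have index: "Pow {..<Suc d} = Pow {0..d}"
    by (simp add: lessThan_Suc_atMost atMost_atLeast0)
  have "(\<Sum>X | X \<subset> {0..d}. (-1) ^ (card X + d) * int (I_count (m_tuple d X A B) L))
      = int (I_count A L) - (1 - (-1) ^ d) * M"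
    unfolding M_def
  proof (rule exchange_sum_eq[OF fin])
    show "m_tuple d {0..d} A B = A"
      unfolding m_tuple_eq_map[OF assms(5) lenA order_refl] 
      by (rule trans[OF _ A], rule map_cong) auto
    fix l assume l: "l \<in> L"
    show "(\<Sum>X\<in>Pow {..<Suc d}. (-1) ^ card X * crossing (map real (m_tuple d X A B)) l)
        = (1 - (-1) ^ d) * of_bool (K l)"
    proof -
      have "(\<Sum>X\<in>Pow {..<Suc d}. (-1) ^ card X * crossing (map real (m_tuple d X A B)) l)
          = (\<Sum>X\<in>Pow {..<Suc d}. (-1) ^ card X * crossing (map (\<lambda>k. if k \<in> X then i k else j k) [0..<Suc d]) l)"
        by (rule sum.cong) (simp_all only: index Pow_iff m)
      also have "\<dots> = (1 - (-1) ^ d) * of_bool (K l)"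
        unfolding K_def by (rule alternating_sum_crossing_m) (use len[OF l] ij ji ne[OF l] in auto)
      finally show ?thesis .
    qed
  qed
  moreover have "(\<Sum>X | X \<subset> {0..d}. (-1) ^ (card X + d) * int (I_count (n_tuple d X A B) L))
      = int (I_count A L) - (1 - (-1) ^ d) * N"
    unfolding N_def
  proof (rule exchange_sum_eq[OF fin])
    show "n_tuple d {0..d} A B = A"
      unfolding n_tuple_eq_map[OF assms(5) lenA order_refl] 
      by (rule trans[OF _ A], rule map_cong) (auto simp: n_entry_def)
    fix l assume l: "l \<in> L"
    show "(\<Sum>X\<in>Pow {..<Suc d}. (-1) ^ card X * crossing (map real (n_tuple d X A B)) l)
        = (1 - (-1) ^ d) * (of_bool (P l) + of_bool (R l))"
    proof -
      have "(\<Sum>X\<in>Pow {..<Suc d}. (-1) ^ card X * crossing (map real (n_tuple d X A B)) l)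
          = (\<Sum>X\<in>Pow {..<Suc d}. (-1) ^ card X * crossing (map (n_entry d X i j) [0..<Suc d]) l)"
        by (rule sum.cong) (simp_all only: index Pow_iff n)
      also have "\<dots> = (1 - (-1) ^ d) * (of_bool (P l) + of_bool (R l))"
        unfolding P_def R_def by (rule alternating_sum_crossing_n) (use len[OF l] ij ji ne[OF l] in auto)
      finally show ?thesis .
    qed
  qed
  moreover have "M \<ge> 0" "N \<ge> 0"
    unfolding M_def N_def by (auto intro: sum_nonneg)
  moreover have "M = 0 \<or> N = 0"
  proof (rule ccontr)
    assume "\<not> (M = 0 \<or> N = 0)"
    then obtain l l' where l: "l \<in> L" "of_bool (K l) \<noteq> (0::int)"
      and l': "l' \<in> L" "of_bool (P l') + of_bool (R l') \<noteq> (0::int)"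
      unfolding M_def N_def by (auto elim!: sum.not_neutral_contains_not_neutral)
    hence K: "K l" and PR: "P l' \<or> R l'" by (auto simp: of_bool_def split: if_splits)
    have lens: "length l = Suc d" "length l' = Suc d"
      using len l l' by auto
    from PR show False
    proof
      assume P: "P l'"
      have "l ! k < l' ! k" if "k \<le> d" for k
      proof -
        have "l ! k < j k" "j k < l' ! k"
          using K P that by (cases "k = d"; simp add: K_def P_def)+
        thus ?thesis by simp
      qed
      moreover have "l' ! k < l ! Suc k" if "k < d" for k
      proof -
        have "l' ! k < i (Suc k)" "i (Suc k) < l ! Suc k"
          using K P that by (simp_all add: K_def P_def)
        thus ?thesis by simp
      qed
      ultimately have "l \<wr> l'"
        unfolding intertwines_def using lens by simp
      thus False using noncross l l' by blast
    next
      assume R: "R l'"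
      have "l' ! k < l ! k" if "k \<le> d" for k
      proof -
        have "l' ! k < i k" "i k < l ! k"
          using K R that by (cases k; simp add: K_def R_def)+
        thus ?thesis by simp
      qed
      moreover have "l ! k < l' ! Suc k" if "k < d" for k
      proof -
        have "l ! k < j k" "j k < l' ! Suc k"
          using K R that by (simp_all add: K_def R_def)
        thus ?thesis by simp
      qed
      ultimately have "l' \<wr> l"
        unfolding intertwines_def using lens by simp
      thus False using noncross l l' by blast
    qed
  qed
  ultimately show "int (I_count A L) =
      max (\<Sum>X | X \<subset> {0..d}. (-1) ^ (card X + d) * int (I_count (m_tuple d X A B) L))
          (\<Sum>X | X \<subset> {0..d}. (-1) ^ (card X + d) * int (I_count (n_tuple d X A B) L))"
    by (cases "even d") auto
qed

end
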